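(* The Poisson structure $\{\,,\,\}_\Omega$ on $\mathbb C^6$ is log-canonical. The Poisson brackets $\{x_i,x_j\}_\Omega$ are the entries (row $i$, column $j$) of the matrix $$\begin{pmatrix} 0&0&-x_1x_3&x_1x_4&x_1x_5&-x_1x_6\\ 0&0&x_2x_3&-x_2x_4&-x_2x_5&x_2x_6\\ x_1x_3&-x_2x_3&0&0&-x_3x_5&x_3x_6\\ -x_1x_4&x_2x_4&0&0&x_4x_5&-x_4x_6\\ -x_1x_5&x_2x_5&x_3x_5&-x_4x_5&0&0\\ x_1x_6&-x_2x_6&-x_3x_6&x_4x_6&0&0 \end{pmatrix}.$$
   Context: Consider $\mathbb C^6$ with coordinates $x=(x_1,\dots,x_6)$, volume form $dV=dx_1\wedge dx_2\wedge dx_3\wedge dx_4\wedge dx_5\wedge dx_6$, and the differential 4-form (writing $dx_{ijkl}=dx_i\wedge dx_j\wedge dx_k\wedge dx_l$) $$\begin{aligned}\Omega=\ &x_1x_3\,dx_{2456}+x_1x_4\,dx_{2356}-x_1x_5\,dx_{2346}-x_1x_6\,dx_{2345}\\&+x_2x_3\,dx_{1456}+x_2x_4\,dx_{1356}-x_2x_5\,dx_{1346}-x_2x_6\,dx_{1345}\\&+x_3x_5\,dx_{1246}+x_3x_6\,dx_{1245}+x_4x_5\,dx_{1236}+x_4x_6\,dx_{1235}.\end{aligned}$$ For functions $f_1,f_2$ on $\mathbb C^6$ put $\{f_1,f_2\}_\Omega=\dfrac{\Omega\wedge df_1\wedge df_2}{dV}$; this is a Poisson structure. A Poisson structure on a space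 with coordinates $x_1,\dots,x_n$ is log-canonical if $\{x_i,x_j\}=a_{ij}x_ix_j$ for all $i,j$, where the $a_{ij}$ are constants. *)

theory Defs
  imports "HOL-Analysis.Analysis" "HOL-Library.Function_Algebras"
begin

text \<open>
  Indices of coordinates are the naturals 1, ..., 6 in their usual order.  (In the index type \<open>6\<close>
  the numeral 6 equals 0, so its own order would put the sixth coordinate first.)
\<close>

definition coord :: "nat \<Rightarrow> complex^6 \<Rightarrow> complex" where
  "coord i p = p $ of_nat i"

definition holomorphic6 :: "(complex^6 \<Rightarrow> complex) \<Rightarrow> bool" where
  "holomorphic6 f \<longleftrightarrow>
     (\<forall>p. \<exists>D. (f has_derivative D) (at p) \<and> (\<forall>c v. D (c *s v) = c * D v))"

definition pdiff :: "nat \<Rightarrow> (complex^6 \<Rightarrow> complex) \<Rightarrow> complex^6 \<Rightarrow> complex" where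
  "pdiff i f p = frechet_derivative f (at p) (axis (of_nat i) 1)"

text \<open>
  Differential forms on \<open>\<complex>\<^sup>6\<close> make up the exterior algebra of the free module with basis
  \<open>dx\<^sub>1, \<dots>, dx\<^sub>6\<close> over the functions on \<open>\<complex>\<^sup>6\<close>.  A form is given by its coefficients:
  \<open>\<omega> I\<close> is the coefficient of \<open>dx\<^sub>I = dx\<^sub>i\<^sub>1 \<and> \<dots> \<and> dx\<^sub>i\<^sub>k\<close>, where
  \<open>I = {i\<^sub>1 < \<dots> < i\<^sub>k}\<close>.  Addition is pointwise.
\<close>

type_synonym form = "nat set \<Rightarrow> complex^6 \<Rightarrow> complex"

definition fscale :: "(complex^6 \<Rightarrow> complex) \<Rightarrow> form \<Rightarrow> form" (infixr "*\<^sub>F" 75) where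
  "h *\<^sub>F \<omega> = (\<lambda>I p. h p * \<omega> I p)"

text \<open>
  For disjoint \<open>I\<close> and \<open>J\<close> one has \<open>dx\<^sub>I \<and> dx\<^sub>J = shuffle_sign I J dx\<^sub>K\<close> with \<open>K = I \<union> J\<close>: the
  exponent is the number of transpositions of neighbours that sort \<open>I\<close> followed by \<open>J\<close>.  If
  \<open>I\<close> and \<open>J\<close> meet, the product is zero.
\<close>

definition shuffle_sign :: "nat set \<Rightarrow> nat set \<Rightarrow> complex" where
  "shuffle_sign I J = (- 1) ^ card {(i, j). i \<in> I \<and> j \<in> J \<and> j < i}"

definition wedge :: "form \<Rightarrow> form \<Rightarrow> form" (infixl "\<curlywedge>" 70) where
  "\<alpha> \<curlywedge> \<beta> = (\<lambda>K p. \<Sum>I\<in>Pow K. shuffle_sign I (K - I) * \<alpha> I p * \<beta> (K - I) p)"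

definition dx :: "nat \<Rightarrow> form" where
  "dx i = (\<lambda>I p. if I = {i} then 1 else 0)"

definition dx4 :: "nat \<Rightarrow> nat \<Rightarrow> nat \<Rightarrow> nat \<Rightarrow> form" where
  "dx4 i j k l = dx i \<curlywedge> dx j \<curlywedge> dx k \<curlywedge> dx l"

definition dfun :: "(complex^6 \<Rightarrow> complex) \<Rightarrow> form" where
  "dfun f = (\<Sum>i = 1..6. pdiff i f *\<^sub>F dx i)"

definition dV :: form where
  "dV = dx 1 \<curlywedge> dx 2 \<curlywedge> dx 3 \<curlywedge> dx 4 \<curlywedge> dx 5 \<curlywedge> dx 6"

definition div_dV :: "form \<Rightarrow> complex^6 \<Rightarrow> complex" where
  "div_dV \<omega> = (THE h. \<omega> = h *\<^sub>F dV)"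

abbreviation X :: "nat \<Rightarrow> complex^6 \<Rightarrow> complex" where
  "X \<equiv> coord"

definition Omega :: form where
  "Omega =
      (X 1 * X 3) *\<^sub>F dx4 2 4 5 6 + (X 1 * X 4) *\<^sub>F dx4 2 3 5 6
    - (X 1 * X 5) *\<^sub>F dx4 2 3 4 6 - (X 1 * X 6) *\<^sub>F dx4 2 3 4 5
    + (X 2 * X 3) *\<^sub>F dx4 1 4 5 6 + (X 2 * X 4) *\<^sub>F dx4 1 3 5 6
    - (X 2 * X 5) *\<^sub>F dx4 1 3 4 6 - (X 2 * X 6) *\<^sub>F dx4 1 3 4 5
    + (X 3 * X 5) *\<^sub>F dx4 1 2 4 6 + (X 3 * X 6) *\<^sub>F dx4 1 2 4 5
    + (X 4 * X 5) *\<^sub>F dx4 1 2 3 6 + (X 4 * X 6) *\<^sub>F dx4 1 2 3 5"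

definition bracket_Omega ::
  "(complex^6 \<Rightarrow> complex) \<Rightarrow> (complex^6 \<Rightarrow> complex) \<Rightarrow> complex^6 \<Rightarrow> complex" where
  "bracket_Omega f g = div_dV (Omega \<curlywedge> dfun f \<curlywedge> dfun g)"

text \<open>
  A Poisson structure on \<open>\<complex>\<^sup>6\<close> is a Poisson bracket on the algebra of entire functions; linearity
  and the Leibniz rule in the second argument follow by skew-symmetry.
\<close>

definition poisson_structure ::
  "((complex^6 \<Rightarrow> complex) \<Rightarrow> (complex^6 \<Rightarrow> complex) \<Rightarrow> complex^6 \<Rightarrow> complex) \<Rightarrow> bool" where
  "poisson_structure br \<longleftrightarrow>
     (\<forall>f g. holomorphic6 f \<and> holomorphic6 g \<longrightarrow>
        holomorphic6 (br f g) \<and>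
        br g f = - br f g \<and>
        (\<forall>c. br (\<lambda>p. c * f p) g = (\<lambda>p. c * br f g p))) \<and>
     (\<forall>f g h. holomorphic6 f \<and> holomorphic6 g \<and> holomorphic6 h \<longrightarrow>
        br (f + g) h = br f h + br g h \<and>
        br (f * g) h = f * br g h + g * br f h \<and>
        br f (br g h) + br g (br h f) + br h (br f g) = 0)"

definition log_canonical ::
  "((complex^6 \<Rightarrow> complex) \<Rightarrow> (complex^6 \<Rightarrow> complex) \<Rightarrow> complex^6 \<Rightarrow> complex) \<Rightarrow> bool" where
  "log_canonical br \<longleftrightarrow> poisson_structure br \<and>
     (\<exists>a :: nat \<Rightarrow> nat \<Rightarrow> complex. \<forall>i\<in>{1..6}. \<forall>j\<in>{1..6}. \<forall>p.
        br (coord i) (coord j) p = a i j * coord i p * coord j p)"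

end

theory Submission
  imports Defs "HOL-Complex_Analysis.Cauchy_Integral_Formula"
begin

text \<open>
  Wedging \<open>\<Omega>\<close> with \<open>dx\<^sub>i\<close> and \<open>dx\<^sub>j\<close> kills every monomial of \<open>\<Omega>\<close> whose index set meets
  \<open>{i, j}\<close>.  A pair of distinct indices has only one complement of size four in \<open>{1..6}\<close>, so at most
  one of the twelve terms of \<open>\<Omega>\<close> survives.  The coefficient in front of that term is, up to sign,
  \<open>x\<^sub>i x\<^sub>j\<close>: this is how \<open>\<Omega>\<close> was made.  The pairs \<open>{1, 2}\<close>, \<open>{3, 4}\<close>, \<open>{5, 6}\<close> are the ones
  whose complement does not occur.  Hence \<open>\<Omega> \<and> dx\<^sub>i \<and> dx\<^sub>j = a\<^sub>i\<^sub>j x\<^sub>i x\<^sub>j dV\<close> with \<open>a\<^sub>i\<^sub>j \<in> {0, 1, -1}\<close>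
  (\<open>Omega_dx_dx\<close>), and by bilinearity
    \<open>{f, g} = \<Sum>\<^sub>i\<^sub>j a\<^sub>i\<^sub>j (\<delta>\<^sub>i f) (\<delta>\<^sub>j g)\<close>, where \<open>\<delta>\<^sub>i = x\<^sub>i \<partial>\<^sub>i\<close>
  (\<open>bracket_Omega_eq_euler\<close>).  The matrix of brackets of coordinates can be read off from this.

  The Poisson axioms hold for every bracket of this shape, because the coefficients \<open>a\<^sub>i\<^sub>j\<close> are constant
  and antisymmetric and the \<open>\<delta>\<^sub>i\<close> are commuting derivations.  Only the Jacobi identity takes an idea.
  Put \<open>T(f, g, h) = \<Sum> a\<^sub>i\<^sub>j a\<^sub>k\<^sub>l (\<delta>\<^sub>i f) (\<delta>\<^sub>j \<delta>\<^sub>k g) (\<delta>\<^sub>l h)\<close>.  The product rule gives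
  \<open>{f, {g, h}} = T(f, g, h) - T(g, h, f)\<close>, and the cyclic sum of such differences telescopes
  (\<open>nested_antisymmetric_form\<close>, \<open>bracket_jacobi\<close>).

  What remains is analysis: the bracket has to stay inside the algebra of entire functions, and the
  \<open>\<delta>\<^sub>i\<close> have to commute on it.  An entire function is one with a complex-linear derivative at
  each point, and everything else follows from Cauchy's formula on complex lines,
    \<open>D\<^sub>v f(p) = \<integral>\<^sub>0\<^sup>1 f(p + e(t) v) / e(t) dt\<close> with \<open>e(t) = exp (2 \<pi> \<i> t)\<close>
  (\<open>dir_deriv_Cauchy\<close>; \<open>e\<close> is \<open>unit_circle\<close> below).  It shows that derivatives are continuous;
  differentiation under the integral sign then shows that they are entire (\<open>entire_dir_deriv\<close>), and the
  same formula, read for \<open>D\<^sub>w f\<close> in place of \<open>f\<close>, shows that second derivatives are symmetric (\<open>dir_deriv_commute\<close>).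
\<close>

section \<open>Monomials and bilinearity in the exterior algebra\<close>

definition dx_set :: "nat set \<Rightarrow> form" where
  "dx_set I = (\<lambda>J p. if J = I then 1 else 0)"

lemma dx_eq_dx_set: "dx i = dx_set {i}"
  by (simp add: dx_def dx_set_def)

lemma wedge_add_left: "(\<alpha> + \<beta>) \<curlywedge> \<gamma> = \<alpha> \<curlywedge> \<gamma> + \<beta> \<curlywedge> \<gamma>"
  by (simp add: wedge_def fun_eq_iff algebra_simps sum.distrib)

lemma wedge_diff_left: "(\<alpha> - \<beta>) \<curlywedge> \<gamma> = \<alpha> \<curlywedge> \<gamma> - \<beta> \<curlywedge> \<gamma>"
  by (simp add: wedge_def fun_eq_iff algebra_simps sum_subtractf)

lemma wedge_minus_left: "(- \<alpha>) \<curlywedge> \<gamma> = - (\<alpha> \<curlywedge> \<gamma>)"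
  by (simp add: wedge_def fun_eq_iff sum_negf)

lemma wedge_add_right: "\<alpha> \<curlywedge> (\<beta> + \<gamma>) = \<alpha> \<curlywedge> \<beta> + \<alpha> \<curlywedge> \<gamma>"
  by (simp add: wedge_def fun_eq_iff algebra_simps sum.distrib)

lemma wedge_zero_left: "0 \<curlywedge> \<alpha> = 0"
  by (simp add: wedge_def fun_eq_iff)

lemma wedge_zero_right: "\<alpha> \<curlywedge> 0 = 0"
  by (simp add: wedge_def fun_eq_iff)

lemma wedge_scale_left: "(h *\<^sub>F \<alpha>) \<curlywedge> \<beta> = h *\<^sub>F (\<alpha> \<curlywedge> \<beta>)"
  by (simp add: wedge_def fscale_def fun_eq_iff sum_distrib_left ac_simps)

lemma wedge_scale_right: "\<alpha> \<curlywedge> (h *\<^sub>F \<beta>) = h *\<^sub>F (\<alpha> \<curlywedge> \<beta>)"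
  by (simp add: wedge_def fscale_def fun_eq_iff sum_distrib_left ac_simps)

lemma wedge_sum_left: "(\<Sum>i\<in>S. \<alpha> i) \<curlywedge> \<beta> = (\<Sum>i\<in>S. \<alpha> i \<curlywedge> \<beta>)"
  by (induction S rule: infinite_finite_induct)
    (simp_all only: sum.infinite sum.empty sum.insert wedge_zero_left wedge_add_left not_False_eq_True)

lemma wedge_sum_right: "\<beta> \<curlywedge> (\<Sum>i\<in>S. \<alpha> i) = (\<Sum>i\<in>S. \<beta> \<curlywedge> \<alpha> i)"
  by (induction S rule: infinite_finite_induct)
    (simp_all only: sum.infinite sum.empty sum.insert wedge_zero_right wedge_add_right not_False_eq_True)

text \<open>
  In the sum that defines the coefficient of the product at \<open>K\<close>, only the summand at \<open>I\<close> can be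
  nonzero, and it is nonzero only if \<open>K - I = J\<close>.  An infinite \<open>K\<close> gets the coefficient \<open>0\<close>, since a
  sum over its infinite power set is \<open>0\<close>; this agrees with the right-hand side for finite \<open>I\<close> and
  \<open>J\<close>.
\<close>

lemma wedge_dx_set:
  assumes "finite I" "finite J"
  shows "dx_set I \<curlywedge> dx_set J =
    (if I \<inter> J = {} then (\<lambda>p. shuffle_sign I J) *\<^sub>F dx_set (I \<union> J) else 0)"
proof (intro ext)
  fix K p
  have summand: "shuffle_sign L (K - L) * dx_set I L p * dx_set J (K - L) p =
      (if L = I then (if K - I = J then shuffle_sign I J else 0) else 0)" for L
    by (simp add: dx_set_def)
  have "(dx_set I \<curlywedge> dx_set J) K p =
      (if finite K \<and> I \<subseteq> K \<and> K - I = J then shuffle_sign I J else 0)"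
    by (cases "finite K") (simp_all add: wedge_def summand sum.delta finite_Pow_iff)
  moreover have "finite K \<and> I \<subseteq> K \<and> K - I = J \<longleftrightarrow> I \<inter> J = {} \<and> K = I \<union> J"
    using assms by auto
  ultimately show "(dx_set I \<curlywedge> dx_set J) K p =
      (if I \<inter> J = {} then (\<lambda>p. shuffle_sign I J) *\<^sub>F dx_set (I \<union> J) else 0) K p"
    by (simp add: fscale_def dx_set_def)
qed

lemma shuffle_sign_empty: "shuffle_sign {} J = 1"
  by (simp add: shuffle_sign_def)

text \<open>
  Rewriting with this rule computes the sign of any explicitly listed index set.
\<close>

lemma shuffle_sign_insert:
  assumes "finite I" "a \<notin> I"
  shows "shuffle_sign (insert a I) {i} = (if i < a then - 1 else 1) * shuffle_sign I {i}"
proof -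
  have pairs: "{(k, j). k \<in> L \<and> j \<in> {i} \<and> j < k} = (\<lambda>k. (k, i)) ` {k \<in> L. i < k}" for L :: "nat set"
    by auto
  have "card {(k, j). k \<in> L \<and> j \<in> {i} \<and> j < k} = card {k \<in> L. i < k}" for L
    unfolding pairs by (rule card_image) (simp add: inj_on_def)
  then have "shuffle_sign L {i} = (- 1) ^ card {k \<in> L. i < k}" for L
    by (simp only: shuffle_sign_def)
  moreover have "{k \<in> insert a I. i < k} =
      (if i < a then insert a {k \<in> I. i < k} else {k \<in> I. i < k})"
    by auto
  ultimately show ?thesis
    using assms by simp
qed

lemma fscale_fscale: "g *\<^sub>F h *\<^sub>F \<omega> = (g * h) *\<^sub>F \<omega>"
  by (simp add: fscale_def fun_eq_iff)

lemma fscale_zero: "h *\<^sub>F 0 = 0"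
  by (simp add: fscale_def fun_eq_iff)

lemma sum_form_apply: "(\<Sum>i\<in>S. \<alpha> i) I p = (\<Sum>i\<in>S. (\<alpha> i :: form) I p)"
  by (induction S rule: infinite_finite_induct) simp_all

lemma fscale_sum: "h *\<^sub>F (\<Sum>i\<in>S. \<alpha> i) = (\<Sum>i\<in>S. h *\<^sub>F \<alpha> i)"
  by (simp add: fscale_def fun_eq_iff sum_form_apply sum_distrib_left)

lemma fscale_one: "(\<lambda>p. 1) *\<^sub>F \<omega> = \<omega>"
  by (simp add: fscale_def fun_eq_iff)

lemma wedge_dx_set_dx:
  assumes "finite I"
  shows "dx_set I \<curlywedge> dx i =
    (if i \<in> I then 0 else (\<lambda>p. shuffle_sign I {i}) *\<^sub>F dx_set (insert i I))"
  using assms by (simp add: dx_eq_dx_set wedge_dx_set)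

lemma wedge_dx_dx: "dx i \<curlywedge> dx j =
    (if i = j then 0 else (\<lambda>p. shuffle_sign {i} {j}) *\<^sub>F dx_set {i, j})"
  using wedge_dx_set_dx[of "{i}" j] by (auto simp: dx_eq_dx_set insert_commute)

lemma dx4_eq_dx_set:
  assumes "i < j" "j < k" "k < l"
  shows "dx4 i j k l = dx_set {i, j, k, l}"
  using assms
  by (simp add: dx4_def wedge_dx_dx wedge_dx_set_dx shuffle_sign_insert shuffle_sign_empty
      fscale_one insert_commute)

lemma dV_eq_dx_set: "dV = dx_set {1, 2, 3, 4, 5, 6}"
  by (simp add: dV_def wedge_dx_dx wedge_dx_set_dx shuffle_sign_insert shuffle_sign_empty
      fscale_one insert_commute)

text \<open>
  The quotient is unique because the coefficient of \<open>dV\<close> at \<open>{1, \<dots>, 6}\<close> is the constant \<open>1\<close>.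
\<close>

lemma div_dV_scale: "div_dV (h *\<^sub>F dV) = h"
  unfolding div_dV_def
proof (rule the_equality)
  fix g assume "h *\<^sub>F dV = g *\<^sub>F dV"
  then have "(h *\<^sub>F dV) {1, 2, 3, 4, 5, 6} p = (g *\<^sub>F dV) {1, 2, 3, 4, 5, 6} p" for p
    by simp
  then show "g = h"
    by (simp add: fun_eq_iff fscale_def dV_eq_dx_set dx_set_def)
qed simp

section \<open>The bracket in coordinates\<close>

definition log_coeff :: "nat \<Rightarrow> nat \<Rightarrow> complex" where
  "log_coeff i j =
    [[0, 0, -1, 1, 1, -1],
     [0, 0, 1, -1, -1, 1],
     [1, -1, 0, 0, -1, 1],
     [-1, 1, 0, 0, 1, -1],
     [-1, 1, 1, -1, 0, 0],
     [1, -1, -1, 1, 0, 0]] ! (i - 1) ! (j - 1)"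

lemma atLeastAtMost_1_6: "{1..6::nat} = {1, 2, 3, 4, 5, 6}"
  by auto

lemma log_coeff_antisym:
  assumes "i \<in> {1..6}" "j \<in> {1..6}"
  shows "log_coeff i j = - log_coeff j i"
  using assms unfolding atLeastAtMost_1_6 by (auto simp: log_coeff_def)

lemma Omega_eq_dx_set: "Omega =
      (X 1 * X 3) *\<^sub>F dx_set {2,4,5,6} + (X 1 * X 4) *\<^sub>F dx_set {2,3,5,6}
    - (X 1 * X 5) *\<^sub>F dx_set {2,3,4,6} - (X 1 * X 6) *\<^sub>F dx_set {2,3,4,5}
    + (X 2 * X 3) *\<^sub>F dx_set {1,4,5,6} + (X 2 * X 4) *\<^sub>F dx_set {1,3,5,6}
    - (X 2 * X 5) *\<^sub>F dx_set {1,3,4,6} - (X 2 * X 6) *\<^sub>F dx_set {1,3,4,5}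
    + (X 3 * X 5) *\<^sub>F dx_set {1,2,4,6} + (X 3 * X 6) *\<^sub>F dx_set {1,2,4,5}
    + (X 4 * X 5) *\<^sub>F dx_set {1,2,3,6} + (X 4 * X 6) *\<^sub>F dx_set {1,2,3,5}"
  unfolding Omega_def by (simp only: dx4_eq_dx_set numeral_less_iff one_less_numeral_iff semiring_norm)

text \<open>
  All of the information in \<open>\<Omega>\<close> enters here: for each of the 36 pairs, at most one of the twelve terms
  survives, and the sign of the permutation that sorts the indices gives the entry of the matrix.
\<close>

lemma Omega_dx_dx:
  assumes "i \<in> {1..6}" "j \<in> {1..6}"
  shows "Omega \<curlywedge> dx i \<curlywedge> dx j = (\<lambda>p. log_coeff i j * coord i p * coord j p) *\<^sub>F dV"
  using assms unfolding atLeastAtMost_1_6 Omega_eq_dx_set dV_eq_dx_set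
  by (simp only: insert_iff empty_iff simp_thms, elim disjE,
      simp_all add: wedge_add_left wedge_diff_left wedge_minus_left wedge_scale_left wedge_dx_set_dx
        shuffle_sign_insert shuffle_sign_empty fscale_zero fscale_fscale fscale_one
        wedge_zero_left insert_commute log_coeff_def,
      simp_all add: fscale_def fun_eq_iff mult.commute)

lemma bracket_Omega_eq:
  "bracket_Omega f g p = (\<Sum>i=1..6. \<Sum>j=1..6.
     log_coeff i j * (coord i p * pdiff i f p) * (coord j p * pdiff j g p))"
proof -
  let ?h = "\<lambda>p. \<Sum>i=1..6. \<Sum>j=1..6.
     log_coeff i j * (coord i p * pdiff i f p) * (coord j p * pdiff j g p)"
  have "Omega \<curlywedge> dfun f \<curlywedge> dfun g =
      (\<Sum>j=1..6. \<Sum>i=1..6. pdiff j g *\<^sub>F pdiff i f *\<^sub>F (Omega \<curlywedge> dx i \<curlywedge> dx j))"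
    by (simp only: dfun_def wedge_sum_left wedge_sum_right wedge_scale_left wedge_scale_right
        fscale_sum)
  also have "\<dots> = (\<Sum>i=1..6. \<Sum>j=1..6. pdiff j g *\<^sub>F pdiff i f *\<^sub>F (Omega \<curlywedge> dx i \<curlywedge> dx j))"
    by (rule sum.swap)
  also have "\<dots> = (\<Sum>i=1..6. \<Sum>j=1..6. pdiff j g *\<^sub>F pdiff i f *\<^sub>F
      (\<lambda>p. log_coeff i j * coord i p * coord j p) *\<^sub>F dV)"
    by (intro sum.cong refl) (simp only: Omega_dx_dx)
  also have "\<dots> = ?h *\<^sub>F dV"
    by (simp add: fun_eq_iff fscale_def sum_distrib_left sum_form_apply ac_simps)
  finally show ?thesis
    by (simp add: bracket_Omega_def div_dV_scale)
qed
section \<open>Derivatives of entire functions of several variables\<close>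

definition entire :: "(complex^'n \<Rightarrow> complex) \<Rightarrow> bool" where
  "entire f \<longleftrightarrow>
     (\<forall>p. \<exists>D. (f has_derivative D) (at p) \<and> (\<forall>c v. D (c *s v) = c * D v))"

definition dir_deriv :: "complex^'n \<Rightarrow> (complex^'n \<Rightarrow> complex) \<Rightarrow> complex^'n \<Rightarrow> complex" where
  "dir_deriv v f p = frechet_derivative f (at p) v"

lemma entire_has_derivative:
  assumes "entire f"
  shows "(f has_derivative (\<lambda>v. dir_deriv v f p)) (at p)"
  using assms unfolding entire_def dir_deriv_def
  by (metis frechet_derivative_at)

lemma entire_dir_deriv_scale:
  assumes "entire f"
  shows "dir_deriv (c *s v) f p = c * dir_deriv v f p"
  using assms unfolding entire_def dir_deriv_def
  by (metis frechet_derivative_at)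

lemma dir_deriv_eqI: "(f has_derivative D) (at p) \<Longrightarrow> dir_deriv v f p = D v"
  unfolding dir_deriv_def by (metis frechet_derivative_at)

lemma bounded_linear_scale_vector: "bounded_linear (\<lambda>z::complex. z *s (v::complex^'n))"
  by (rule linear_conv_bounded_linear[THEN iffD1], rule linearI)
     (simp_all add: vec_eq_iff algebra_simps)

lemmas has_derivative_scale_vector = bounded_linear.has_derivative[OF bounded_linear_scale_vector]
lemmas continuous_on_scale_vector = bounded_linear.continuous_on[OF bounded_linear_scale_vector]

definition unit_circle :: "real \<Rightarrow> complex" where "unit_circle t = exp (2 * of_real pi * \<i> * of_real t)"

lemma continuous_on_unit_circle: "continuous_on S unit_circle"
  unfolding unit_circle_def by (intro continuous_intros)

lemma unit_circle_nonzero [simp]: "unit_circle t \<noteq> 0" by (simp add: unit_circle_def)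

lemma entire_continuous: "entire f \<Longrightarrow> continuous_on S f"
  by (intro continuous_at_imp_continuous_on ballI has_derivative_continuous[OF entire_has_derivative])

text \<open>
  Restricting to a complex line reduces questions in several variables to the Cauchy theory of one
  variable.
\<close>

lemma entire_line:
  assumes "entire f"
  shows "((\<lambda>z. f (p + z *s v)) has_field_derivative dir_deriv v f (p + z *s v)) (at z)"
proof -
  have "((\<lambda>z. p + z *s v) has_derivative (\<lambda>z. z *s v)) (at z)"
    by (auto intro!: derivative_eq_intros has_derivative_scale_vector)
  from has_derivative_compose[OF this entire_has_derivative[OF assms]]
  show ?thesis
    by (simp add: has_field_derivative_def entire_dir_deriv_scale[OF assms]
        mult.commute[of _ "dir_deriv v f (p + z *s v)"])
qed

text \<open>
  Cauchy's formula for the first derivative at \<open>0\<close> of \<open>z \<mapsto> f (p + z v)\<close>, over the unit circle: the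
  factors \<open>2 \<pi> \<i>\<close> cancel and one factor \<open>e(t)\<close> of the denominator is absorbed by the velocity of the
  circle.  It expresses a derivative of \<open>f\<close> through values of \<open>f\<close> alone.
\<close>

lemma dir_deriv_Cauchy:
  assumes "entire f"
  shows "dir_deriv v f p = integral {0..1} (\<lambda>t. f (p + unit_circle t *s v) / unit_circle t)"
proof -
  let ?\<phi> = "\<lambda>z. f (p + z *s v)"
  have holo: "?\<phi> holomorphic_on S" for S
    unfolding holomorphic_on_def field_differentiable_def
    using has_field_derivative_at_within[OF entire_line[OF assms]] by blast
  have "(?\<phi> has_field_derivative (1 / (2 * of_real pi * \<i>) *
      contour_integral (circlepath 0 1) (\<lambda>u. ?\<phi> u / (u - 0)\<^sup>2))) (at 0)"
    using Cauchy_derivative_integral_circlepath(2)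
        [OF holomorphic_on_imp_continuous_on[OF holo] holo, of 0 0 1] by simp
  from DERIV_unique[OF entire_line[OF assms] this]
  have "dir_deriv v f p = 1 / (2 * of_real pi * \<i>) *
      contour_integral (circlepath 0 1) (\<lambda>u. ?\<phi> u / (u - 0)\<^sup>2)"
    by simp
  also have "\<dots> = integral {0..1} (\<lambda>t. 1 / (2 * of_real pi * \<i>) *
      (?\<phi> (unit_circle t) / (unit_circle t)\<^sup>2 * (2 * pi * \<i> * unit_circle t)))"
  proof -
    have "contour_integral (circlepath 0 1) (\<lambda>u. ?\<phi> u / (u - 0)\<^sup>2) =
        integral {0..1} (\<lambda>t. ?\<phi> (unit_circle t) / (unit_circle t)\<^sup>2 * (2 * pi * \<i> * unit_circle t))"
      unfolding contour_integral_integral vector_derivative_circlepath by (simp add: circlepath unit_circle_def)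
    then show ?thesis by (simp only: integral_mult_right)
  qed
  also have "\<dots> = integral {0..1} (\<lambda>t. f (p + unit_circle t *s v) / unit_circle t)"
  proof (rule integral_cong)
    fix t
    have cancel: "1 / c * (y / z\<^sup>2 * (c * z)) = y / z" if "c \<noteq> 0" "z \<noteq> 0" for c y z :: complex
      using that by (simp add: field_simps power2_eq_square)
    show "1 / (2 * of_real pi * \<i>) *
        (?\<phi> (unit_circle t) / (unit_circle t)\<^sup>2 * (2 * pi * \<i> * unit_circle t)) = ?\<phi> (unit_circle t) / unit_circle t"
      using cancel[of "2 * of_real pi * \<i>" "unit_circle t" "?\<phi> (unit_circle t)"]
      by (simp only: of_real_mult of_real_numeral) simp
  qed
  finally show ?thesis .
qed

lemma continuous_on_Cauchy_integrand:
  assumes "entire f"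
  shows "continuous_on (S \<times> T) (\<lambda>(p, t). f (p + unit_circle t *s v) / unit_circle t)"
  unfolding case_prod_unfold
  by (intro continuous_intros continuous_on_compose2[OF entire_continuous[OF assms, of UNIV]]
      continuous_on_compose2[OF continuous_on_unit_circle[of UNIV]] continuous_on_scale_vector) auto

text \<open>
  The integrand in Cauchy's formula is jointly continuous because \<open>f\<close> is; so the mere existence of the
  derivative forces its continuity.
\<close>

lemma continuous_on_dir_deriv:
  assumes "entire f"
  shows "continuous_on S (dir_deriv v f)"
proof -
  have "continuous_on S (\<lambda>p. integral (cbox 0 1) (\<lambda>t. f (p + unit_circle t *s v) / unit_circle t))"
    by (rule integral_continuous_on_param[OF continuous_on_Cauchy_integrand[OF assms]])
  then show ?thesis by (simp add: dir_deriv_Cauchy[OF assms, abs_def])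
qed

text \<open>
  Differentiation under the integral sign in Cauchy's formula.  The Leibniz rule asks for a derivative
  that is jointly continuous as an operator-valued map; in finite dimension it suffices to check this
  on basis vectors, where it is the continuity of directional derivatives.
\<close>

lemma has_derivative_dir_deriv:
  assumes "entire f"
  shows "(dir_deriv v f has_derivative
    (\<lambda>w. integral {0..1} (\<lambda>t. dir_deriv w f (p + unit_circle t *s v) / unit_circle t))) (at p)"
proof -
  have "bounded_linear (\<lambda>w. dir_deriv w f q)" for q
    by (rule has_derivative_bounded_linear[OF entire_has_derivative[OF assms]])
  then have bl: "bounded_linear (\<lambda>w. dir_deriv w f q / unit_circle t)" for q t
    by (rule bounded_linear_compose[OF bounded_linear_divide])
  define F where "F q t = Blinfun (\<lambda>w. dir_deriv w f (q + unit_circle t *s v) / unit_circle t)" for q t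
  have F: "blinfun_apply (F q t) w = dir_deriv w f (q + unit_circle t *s v) / unit_circle t" for q t w
    unfolding F_def by (simp add: bounded_linear_Blinfun_apply[OF bl])
  have contF: "continuous_on (S \<times> T) (\<lambda>(q, t). F q t)" for S T
  proof (rule continuous_on_blinfun_componentwise)
    fix i
    show "continuous_on (S \<times> T) (\<lambda>x. blinfun_apply (case x of (q, t) \<Rightarrow> F q t) i)"
      unfolding case_prod_unfold F
      by (intro continuous_intros continuous_on_compose2[OF continuous_on_dir_deriv[OF assms, of UNIV]]
        continuous_on_compose2[OF continuous_on_unit_circle[of UNIV]] continuous_on_scale_vector) auto
  qed
  have int: "F p integrable_on cbox 0 1"
  proof -
    have "continuous_on (cbox 0 1) (\<lambda>t. case (p, t) of (q, t) \<Rightarrow> F q t)"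
      by (rule continuous_on_compose2[OF contF[of UNIV UNIV]]) (simp_all add: continuous_on_Pair)
    then show ?thesis by (simp only: prod.case integrable_continuous)
  qed
  have "((\<lambda>q. integral (cbox 0 1) (\<lambda>t. f (q + unit_circle t *s v) / unit_circle t)) has_derivative
      blinfun_apply (integral (cbox 0 1) (F p))) (at p within UNIV)"
  proof (rule leibniz_rule[OF _ _ contF])
    fix q t
    have "((\<lambda>q. f (q + unit_circle t *s v)) has_derivative
        (\<lambda>w. dir_deriv w f (q + unit_circle t *s v))) (at q)"
      by (rule has_derivative_compose[OF _ entire_has_derivative[OF assms]])
        (auto intro!: derivative_eq_intros)
    then show "((\<lambda>q. f (q + unit_circle t *s v) / unit_circle t) has_derivative
        blinfun_apply (F q t)) (at q within UNIV)"
      unfolding F by (rule bounded_linear.has_derivative[OF bounded_linear_divide])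
  next
    fix q
    show "(\<lambda>t. f (q + unit_circle t *s v) / unit_circle t) integrable_on cbox 0 1"
    proof -
      have "continuous_on (cbox 0 1) (\<lambda>t. case (q, t) of (q, t) \<Rightarrow> f (q + unit_circle t *s v) / unit_circle t)"
        by (rule continuous_on_compose2[OF continuous_on_Cauchy_integrand[OF assms, of UNIV UNIV]])
          (simp_all add: continuous_on_Pair)
      then show ?thesis by (simp only: prod.case integrable_continuous)
    qed
  qed auto
  moreover have "blinfun_apply (integral (cbox 0 1) (F p)) =
      (\<lambda>w. integral {0..1} (\<lambda>t. dir_deriv w f (p + unit_circle t *s v) / unit_circle t))"
    by (rule ext) (simp only: blinfun_apply_integral[OF int[unfolded box_real]] F box_real)
  moreover have "dir_deriv v f = (\<lambda>q. integral (cbox 0 1) (\<lambda>t. f (q + unit_circle t *s v) / unit_circle t))"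
    by (rule ext) (simp only: dir_deriv_Cauchy[OF assms] box_real)
  ultimately show ?thesis
    by (simp only:)
qed

lemma entire_dir_deriv:
  assumes "entire f"
  shows "entire (dir_deriv v f)"
  unfolding entire_def
proof
  fix p
  have "integral {0..1} (\<lambda>t. dir_deriv (c *s w) f (p + unit_circle t *s v) / unit_circle t)
     = c * integral {0..1} (\<lambda>t. dir_deriv w f (p + unit_circle t *s v) / unit_circle t)" for c w
    by (simp add: entire_dir_deriv_scale[OF assms] flip: integral_mult_right)
  with has_derivative_dir_deriv[OF assms]
  show "\<exists>D. (dir_deriv v f has_derivative D) (at p) \<and> (\<forall>c v. D (c *s v) = c * D v)"
    by blast
qed

text \<open>
  Both sides equal \<open>\<integral>\<^sub>0\<^sup>1 D\<^sub>w f(p + e(t) v) / e(t) dt\<close>: the left one by differentiating Cauchy's formula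
  for \<open>D\<^sub>v f\<close>, the right one by Cauchy's formula for the entire function \<open>D\<^sub>w f\<close>.
\<close>

lemma dir_deriv_commute:
  assumes "entire f"
  shows "dir_deriv w (dir_deriv v f) p = dir_deriv v (dir_deriv w f) p"
proof -
  have "dir_deriv w (dir_deriv v f) p = integral {0..1} (\<lambda>t. dir_deriv w f (p + unit_circle t *s v) / unit_circle t)"
    by (rule dir_deriv_eqI[OF has_derivative_dir_deriv[OF assms]])
  also have "\<dots> = dir_deriv v (dir_deriv w f) p"
    by (rule dir_deriv_Cauchy[OF entire_dir_deriv[OF assms], symmetric])
  finally show ?thesis .
qed

section \<open>The algebra of entire functions\<close>

lemma entireI:
  assumes "\<And>p. (f has_derivative D p) (at p)" "\<And>p c v. D p (c *s v) = c * D p v"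
  shows "entire f"
  using assms unfolding entire_def by blast

lemma entire_const: "entire (\<lambda>p. c)"
  by (rule entireI[where D = "\<lambda>p v. 0"]) auto

lemma has_derivative_entire_add:
  assumes "entire f" "entire g"
  shows "((\<lambda>p. f p + g p) has_derivative (\<lambda>v. dir_deriv v f p + dir_deriv v g p)) (at p)"
  by (intro has_derivative_add entire_has_derivative assms)

lemma has_derivative_entire_mult:
  assumes "entire f" "entire g"
  shows "((\<lambda>p. f p * g p) has_derivative (\<lambda>v. f p * dir_deriv v g p + dir_deriv v f p * g p)) (at p)"
  by (intro has_derivative_mult entire_has_derivative assms)

lemma entire_add: "entire f \<Longrightarrow> entire g \<Longrightarrow> entire (\<lambda>p. f p + g p)"
  by (rule entireI, rule has_derivative_entire_add) (simp_all add: entire_dir_deriv_scale distrib_left)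

lemma entire_mult: "entire f \<Longrightarrow> entire g \<Longrightarrow> entire (\<lambda>p. f p * g p)"
  by (rule entireI, rule has_derivative_entire_mult) (simp_all add: entire_dir_deriv_scale algebra_simps)

lemma entire_sum: "(\<And>i. i \<in> S \<Longrightarrow> entire (f i)) \<Longrightarrow> entire (\<lambda>p. \<Sum>i\<in>S. f i p)"
  by (induction S rule: infinite_finite_induct) (auto intro: entire_const entire_add)

lemma dir_deriv_const: "dir_deriv v (\<lambda>p. c) p = 0"
  by (rule dir_deriv_eqI[where D = "\<lambda>v. 0"]) simp

lemmas dir_deriv_add = dir_deriv_eqI[OF has_derivative_entire_add]
lemmas dir_deriv_mult = dir_deriv_eqI[OF has_derivative_entire_mult]

section \<open>Euler operators\<close>

lemma has_derivative_coord: "(coord i has_derivative (\<lambda>v. v $ of_nat i)) (at p)"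
  unfolding coord_def[abs_def] by (rule bounded_linear.has_derivative[OF bounded_linear_vec_nth has_derivative_ident])

lemma entire_coord: "entire (coord i)"
  by (rule entireI[OF has_derivative_coord]) simp

lemma holomorphic6_eq: "holomorphic6 = entire"
  by (simp add: fun_eq_iff holomorphic6_def entire_def)

lemma pdiff_eq: "pdiff i = dir_deriv (axis (of_nat i) 1)"
  by (simp add: fun_eq_iff pdiff_def dir_deriv_def)

text \<open>
  The index type has six elements with \<open>6 = 0\<close>, so the numbers \<open>1, \<dots>, 6\<close> name each of them once.
\<close>

lemma of_nat_6_eq_iff:
  assumes "i \<in> {1..6}" "j \<in> {1..6}"
  shows "(of_nat i :: 6) = of_nat j \<longleftrightarrow> i = j"
  using assms unfolding atLeastAtMost_1_6 by auto

lemma pdiff_coord: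
  assumes "i \<in> {1..6}" "j \<in> {1..6}"
  shows "pdiff i (coord j) p = (if i = j then 1 else 0)"
  using of_nat_6_eq_iff[OF assms]
  by (auto simp: pdiff_eq dir_deriv_eqI[OF has_derivative_coord] axis_def)

text \<open>
  The Euler operator \<open>\<delta>\<^sub>i = x\<^sub>i \<partial>\<^sub>i\<close>.  In terms of the \<open>\<delta>\<^sub>i\<close>, which commute just as the
  \<open>\<partial>\<^sub>i\<close> do, a log-canonical bracket has constant coefficients.
\<close>

definition euler :: "nat \<Rightarrow> (complex^6 \<Rightarrow> complex) \<Rightarrow> complex^6 \<Rightarrow> complex" where
  "euler i f p = coord i p * pdiff i f p"

lemma entire_euler: "entire f \<Longrightarrow> entire (euler i f)"
  unfolding euler_def[abs_def] pdiff_eq by (intro entire_mult entire_coord entire_dir_deriv)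

lemma euler_add: "entire f \<Longrightarrow> entire g \<Longrightarrow> euler i (\<lambda>p. f p + g p) p = euler i f p + euler i g p"
  by (simp add: euler_def pdiff_eq dir_deriv_add distrib_left)

lemma euler_mult: "entire f \<Longrightarrow> entire g \<Longrightarrow> euler i (\<lambda>p. f p * g p) p = f p * euler i g p + euler i f p * g p"
  by (simp add: euler_def pdiff_eq dir_deriv_mult algebra_simps)

lemma euler_const: "euler i (\<lambda>p. c) p = 0"
  by (simp add: euler_def pdiff_eq dir_deriv_const)

lemma euler_cmult: "entire f \<Longrightarrow> euler i (\<lambda>p. c * f p) p = c * euler i f p"
  by (simp add: euler_mult entire_const euler_const)

lemma euler_sum:
  "(\<And>k. k \<in> S \<Longrightarrow> entire (f k)) \<Longrightarrow> euler i (\<lambda>p. \<Sum>k\<in>S. f k p) p = (\<Sum>k\<in>S. euler i (f k) p)"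
  by (induction S rule: infinite_finite_induct) (simp_all add: euler_const euler_add entire_sum)

lemma euler_coord: "i \<in> {1..6} \<Longrightarrow> j \<in> {1..6} \<Longrightarrow> euler i (coord j) p = (if i = j then coord j p else 0)"
  by (simp add: euler_def pdiff_coord)

text \<open>
  By the product rule, \<open>\<delta>\<^sub>i \<delta>\<^sub>j f = x\<^sub>i x\<^sub>j \<partial>\<^sub>i \<partial>\<^sub>j f\<close> plus a term that is present only for
  \<open>i = j\<close>; the first part is symmetric since mixed partial derivatives are.
\<close>

lemma euler_commute:
  assumes "entire f" "i \<in> {1..6}" "j \<in> {1..6}"
  shows "euler i (euler j f) p = euler j (euler i f) p"
proof -
  \<comment> \<open>The claim is stated for arbitrary indices because it is used once for each order of them.\<close>
  have "euler i (euler j f) p = coord j p * (coord i p * pdiff i (pdiff j f) p)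
      + (if i = j then coord j p else 0) * pdiff j f p" if "i \<in> {1..6}" "j \<in> {1..6}" for i j
  proof -
    have "entire (pdiff j f)" using entire_dir_deriv[OF assms(1)] by (simp add: pdiff_eq)
    have "euler i (euler j f) p = euler i (\<lambda>p. coord j p * pdiff j f p) p"
      by (simp only: euler_def[of j, abs_def])
    also have "\<dots> = coord j p * euler i (pdiff j f) p + euler i (coord j) p * pdiff j f p"
      by (rule euler_mult[OF entire_coord \<open>entire (pdiff j f)\<close>])
    finally show ?thesis by (simp only: euler_def[of i "pdiff j f"] euler_coord[OF that])
  qed
  moreover have "pdiff i (pdiff j f) p = pdiff j (pdiff i f) p"
    unfolding pdiff_eq by (rule dir_deriv_commute[OF assms(1)])
  ultimately show ?thesis using assms by (simp add: mult.left_commute)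
qed

section \<open>The Jacobi identity for constant coefficients\<close>

lemma sum_quadruples:
  "(\<Sum>(i, j, k, l) \<in> I \<times> I \<times> I \<times> I. g i j k l) = (\<Sum>i\<in>I. \<Sum>j\<in>I. \<Sum>k\<in>I. \<Sum>l\<in>I. g i j k l)"
  by (simp only: sum.cartesian_product[symmetric])

text \<open>
  The algebraic core of the Jacobi identity.  The vectors \<open>u\<close>, \<open>v\<close>, \<open>w\<close> stand for the first
  derivatives of three functions and the matrices \<open>V\<close>, \<open>W\<close> for second derivatives of the last two, so
  that the inner sum is the product rule for the \<open>j\<close>-th derivative of a bracket.  The half with \<open>V\<close>
  is \<open>T u V w\<close> as it stands.  In the half with \<open>W\<close>, the renaming \<open>(i, j, k, l) \<mapsto> (k, l, j, i)\<close> turns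
  \<open>a\<close> and \<open>W\<close> into their transposes in one factor each; antisymmetry of \<open>a\<close> costs a sign, symmetry of
  \<open>W\<close> costs nothing, and the result is \<open>- T v W u\<close>.
\<close>

lemma nested_antisymmetric_form:
  fixes a :: "'i \<Rightarrow> 'i \<Rightarrow> 'a::comm_ring_1" and I :: "'i set"
  defines "T \<equiv> \<lambda>u V w. \<Sum>(i, j, k, l) \<in> I \<times> I \<times> I \<times> I. a i j * a k l * u i * V j k * w l"
  assumes anti: "\<And>i j. i \<in> I \<Longrightarrow> j \<in> I \<Longrightarrow> a i j = - a j i"
  assumes sym: "\<And>i j. i \<in> I \<Longrightarrow> j \<in> I \<Longrightarrow> W i j = W j i"
  shows "(\<Sum>i\<in>I. \<Sum>j\<in>I. a i j * u i * (\<Sum>k\<in>I. \<Sum>l\<in>I. a k l * (V j k * w l + v k * W j l)))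
    = T u V w - T v W u"
proof -
  have "(\<Sum>i\<in>I. \<Sum>j\<in>I. a i j * u i * (\<Sum>k\<in>I. \<Sum>l\<in>I. a k l * (V j k * w l + v k * W j l)))
      = T u V w + (\<Sum>(i, j, k, l) \<in> I \<times> I \<times> I \<times> I. a i j * a k l * u i * v k * W j l)"
    unfolding T_def sum_quadruples
    by (simp add: sum_distrib_left distrib_left sum.distrib mult.assoc mult.left_commute)
  also have "(\<Sum>(i, j, k, l) \<in> I \<times> I \<times> I \<times> I. a i j * a k l * u i * v k * W j l)
      = (\<Sum>(i, j, k, l) \<in> I \<times> I \<times> I \<times> I. - (a i j * a k l * v i * W j k * u l))"
  proof (rule sum.reindex_bij_witness[of _ "\<lambda>(i, j, k, l). (l, k, i, j)" "\<lambda>(i, j, k, l). (k, l, j, i)"],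
      goal_cases)
    case (5 q)
    then obtain i j k l where "q = (i, j, k, l)" "i \<in> I" "j \<in> I" "l \<in> I"
      by auto
    then show ?case
      using anti[of j i] sym[of l j] by (simp add: ac_simps)
  qed auto
  also have "\<dots> = - T v W u"
    by (simp add: T_def sum_negf case_prod_unfold)
  finally show ?thesis by simp
qed

section \<open>The Poisson structure\<close>

lemma bracket_Omega_eq_euler:
  "bracket_Omega f g = (\<lambda>p. \<Sum>i=1..6. \<Sum>j=1..6. log_coeff i j * (euler i f p * euler j g p))"
  by (simp add: fun_eq_iff bracket_Omega_eq euler_def mult.assoc)

lemma entire_bracket: "entire f \<Longrightarrow> entire g \<Longrightarrow> entire (bracket_Omega f g)"
  unfolding bracket_Omega_eq_euler by (intro entire_sum entire_mult entire_const entire_euler)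

lemma bracket_antisym: "bracket_Omega g f = - bracket_Omega f g"
proof
  fix p
  have "bracket_Omega g f p = (\<Sum>j=1..6. \<Sum>i=1..6. log_coeff i j * (euler i g p * euler j f p))"
    unfolding bracket_Omega_eq_euler by (rule sum.swap)
  also have "\<dots> = (\<Sum>j=1..6. \<Sum>i=1..6. - (log_coeff j i * (euler j f p * euler i g p)))"
    by (intro sum.cong refl) (subst log_coeff_antisym, auto)
  finally show "bracket_Omega g f p = (- bracket_Omega f g) p"
    by (simp add: bracket_Omega_eq_euler sum_negf)
qed

text \<open>
  The operator \<open>\<delta>\<^sub>j\<close> passes through the constant coefficients of the inner bracket, so that no
  derivatives of coefficients appear.
\<close>

lemma bracket_bracket:
  assumes "entire f" "entire g" "entire h"
  shows "bracket_Omega f (bracket_Omega g h) p = (\<Sum>i=1..6. \<Sum>j=1..6. log_coeff i j * euler i f p *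
    (\<Sum>k=1..6. \<Sum>l=1..6. log_coeff k l *
      (euler j (euler k g) p * euler l h p + euler k g p * euler j (euler l h) p)))"
proof -
  have "euler j (bracket_Omega g h) p = (\<Sum>k=1..6. \<Sum>l=1..6. log_coeff k l *
      (euler j (euler k g) p * euler l h p + euler k g p * euler j (euler l h) p))" for j
    unfolding bracket_Omega_eq_euler
    by (simp add: euler_sum euler_cmult euler_mult entire_sum entire_mult entire_const entire_euler assms add.commute)
  then show ?thesis
    by (simp add: bracket_Omega_eq_euler[of f] mult.assoc)
qed

text \<open>
  The trilinear expression \<open>T(f, g, h)\<close> whose differences telescope in the Jacobi identity.
\<close>

definition jacobi_term ::
  "(complex^6 \<Rightarrow> complex) \<Rightarrow> (complex^6 \<Rightarrow> complex) \<Rightarrow> (complex^6 \<Rightarrow> complex) \<Rightarrow> complex^6 \<Rightarrow> complex"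
where
  "jacobi_term f g h p = (\<Sum>(i, j, k, l) \<in> {1..6} \<times> {1..6} \<times> {1..6} \<times> {1..6}.
     log_coeff i j * log_coeff k l * euler i f p * euler j (euler k g) p * euler l h p)"

lemma bracket_bracket_eq_jacobi_terms:
  assumes "entire f" "entire g" "entire h"
  shows "bracket_Omega f (bracket_Omega g h) p = jacobi_term f g h p - jacobi_term g h f p"
  unfolding bracket_bracket[OF assms] jacobi_term_def
  by (rule nested_antisymmetric_form[OF log_coeff_antisym euler_commute[OF assms(3)]])

lemma bracket_jacobi:
  assumes "entire f" "entire g" "entire h"
  shows "bracket_Omega f (bracket_Omega g h) + bracket_Omega g (bracket_Omega h f) +
    bracket_Omega h (bracket_Omega f g) = 0"
  by (rule ext) (simp add: bracket_bracket_eq_jacobi_terms assms)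

lemma bracket_add:
  assumes "entire f" "entire g"
  shows "bracket_Omega (f + g) h = bracket_Omega f h + bracket_Omega g h"
  by (simp add: func_plus bracket_Omega_eq_euler euler_add[OF assms] distrib_right distrib_left sum.distrib)

lemma bracket_cmult:
  assumes "entire f"
  shows "bracket_Omega (\<lambda>p. c * f p) h = (\<lambda>p. c * bracket_Omega f h p)"
  by (simp add: fun_eq_iff bracket_Omega_eq_euler euler_cmult[OF assms] sum_distrib_left mult.left_commute mult.assoc)

lemma bracket_mult:
  assumes "entire f" "entire g"
  shows "bracket_Omega (f * g) h = f * bracket_Omega g h + g * bracket_Omega f h"
  by (simp add: func_plus func_times bracket_Omega_eq_euler euler_mult[OF assms] algebra_simps sum.distrib sum_distrib_left)

lemma poisson_structure_bracket_Omega: "poisson_structure bracket_Omega"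
  unfolding poisson_structure_def holomorphic6_eq
  using entire_bracket bracket_antisym bracket_cmult bracket_add bracket_mult bracket_jacobi
  by blast

lemma bracket_coord:
  assumes "i \<in> {1..6}" "j \<in> {1..6}"
  shows "bracket_Omega (coord i) (coord j) p = log_coeff i j * coord i p * coord j p"
proof -
  have "bracket_Omega (coord i) (coord j) p = (\<Sum>k=1..6. \<Sum>l=1..6.
      if k = i then if l = j then log_coeff i j * coord i p * coord j p else 0 else 0)"
    unfolding bracket_Omega_eq_euler
    by (intro sum.cong refl) (use assms in \<open>simp add: euler_coord\<close>)
  also have "\<dots> = (\<Sum>k=1..6. if k = i then log_coeff i j * coord i p * coord j p else 0)"
    using assms by (intro sum.cong refl) simp
  finally show ?thesis using assms by simp
qed

theorem lemma11p8:
  shows "log_canonical bracket_Omega \<and>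
    (\<forall>p. let x = (\<lambda>i. coord i p) in
      \<forall>i\<in>{1..6}. \<forall>j\<in>{1..6}.
        bracket_Omega (coord i) (coord j) p =
          [[0, 0, - (x 1 * x 3), x 1 * x 4, x 1 * x 5, - (x 1 * x 6)],
           [0, 0, x 2 * x 3, - (x 2 * x 4), - (x 2 * x 5), x 2 * x 6],
           [x 1 * x 3, - (x 2 * x 3), 0, 0, - (x 3 * x 5), x 3 * x 6],
           [- (x 1 * x 4), x 2 * x 4, 0, 0, x 4 * x 5, - (x 4 * x 6)],
           [- (x 1 * x 5), x 2 * x 5, x 3 * x 5, - (x 4 * x 5), 0, 0],
           [x 1 * x 6, - (x 2 * x 6), - (x 3 * x 6), x 4 * x 6, 0, 0]] ! (i - 1) ! (j - 1))"
proof
  show "log_canonical bracket_Omega"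
    unfolding log_canonical_def using poisson_structure_bracket_Omega bracket_coord by blast
qed (unfold Let_def, intro allI ballI, simp only: bracket_coord,
    unfold atLeastAtMost_1_6, auto simp: log_coeff_def)

end
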